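(* Let $S=(b+\mathbb{Z}^n)\cap Q$, where $b\in\mathbb{R}^n\setminus\mathbb{Z}^n$ and $Q\subseteq\mathbb{R}^n$ is a rational polyhedron. Let $B=\{r\in\mathbb{R}^n: a^i\cdot r\le1\ \forall i\in I\}$ be a maximal $S$-free convex $0$-neighborhood, let $\psi(r)=\max_{i\in I}a^i\cdot r$, and let $p^*\in\mathbb{R}^n$. Then $$\mathcal{X}(B,p^* )+W_S\subseteq\mathcal{F}_{\psi,p^*}.$$ Also, if $\pi\in\mathcal{L}_{\psi,p^*}$, $q\in\mathcal{X}(B,p^* )$ and $w\in W_S$, then $$\pi(q+w)=\pi(q)=\psi^*_{[p^*,B]}((q,0)).$$
   Context: $\mathbb{Z}_+$, $\mathbb{R}_+$ denote nonnegative integers and reals. Liftings: for $k,\ell\in\mathbb{Z}_+$ (not both $0$), $R\in\mathbb{R}^{n\times k}$, $P\in\mathbb{R}^{n\times\ell}$, let $X_S(R,P)=\{(s,y)\in\mathbb{R}^k_+\times\mathbb{Z}^\ell_+: Rs+Py\in S\}$. A pair of functions $\psi,\pi:\mathbb{R}^n\to\mathbb{R}$ is a valid pair for $S$ if for all $k,\ell$, $R=(r^1,\dots,r^k)$, $P=(p^1,\dots,p^\ell)$, the inequality $\sum_i\psi(r^i)s_i+\sum_j\pi(p^j)y_j\ge1$ holds for all $(s,y)\in X_S(R,P)$. A lifting of $\psi$ is a function $\pi:\mathbb{R}^n\to\mathbb{R}$ such that $(\psi,\pi)$ is a valid pair for $S$; a minimal lifting is a lifting that is minimal under pointwise order among liftings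 of $\psi$. Put $V_\psi(p^* ):=\inf\{\pi(p^* ):\pi\text{ a minimal lifting of }\psi\}$, $\mathcal{L}_{\psi,p^*}:=\{\pi:\pi\text{ a minimal lifting of }\psi,\ \pi(p^* )=V_\psi(p^* )\}$, and the fixing region $\mathcal{F}_{\psi,p^*}:=\{p\in\mathbb{R}^n:\pi_1(p)=\pi_2(p)\ \forall\pi_1,\pi_2\in\mathcal{L}_{\psi,p^*}\}$. $S$-free sets: a convex set $B\subseteq\mathbb{R}^n$ with $0\in\operatorname{int}(B)$ and $S\cap\operatorname{int}(B)=\emptyset$ is an $S$-free convex $0$-neighborhood; it is maximal if no strict superset of it is an $S$-free convex $0$-neighborhood. For the sets $S$ considered, each maximal one is a polyhedron and is written $B=\{r: a^i\cdot r\le1\ \forall i\in I\}$ with $I$ a finite set indexing the facets of $B$; $\psi(r)=\psi_B(r)=\max_{i\in I}a^i\cdot r$ is its smallest representation. Pyramid: $\Delta:=\{(r,r_{n+1})\in\mathbb{R}^n\times\mathbb{R}_+: a^i\cdot r+(V_\psi(p^* )-a^i\cdot p^* )r_{n+1}\le1\ \forall i\in I\}$, and $\psi_\Delta((r,r_{n+1})):=\max_{i\in I}\{a^i\cdot r+(V_\psi(p^* )-a^i\cdot p^* )r_{n+1}\}$. For a set $T\subseteq\mathbb{R}^d$: $W_T:=\{w: s+\lambda w\in T\ \forall s\in T,\lambda\in\mathbb{Z}\}$, $W_T^+:=\{w: s+\lambda w\in T\ \forall s\in T,\lambda\in\mathbb{Z}_+\}$. For $(r,r_{n+1})\in\mathbb{R}^n\times\mathbb{R}_+$,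 $$\psi^*_{[p^*,B]}((r,r_{n+1})):=\inf\{\psi_\Delta((r,r_{n+1})+(w,z)):(w,z)\in W^+_{S\times\mathbb{Z}_+}\}.$$ Spindle: for $x\in\mathbb{R}^n$, $R_B(x):=\{r\in\mathbb{R}^n:(a^i-a^k)\cdot r\le0\text{ and }(a^i-a^k)\cdot(x-r)\le0\ \forall i\in I\}$, where $k\in I$ is an index with $\psi_B(x)=a^k\cdot x$. Finally $$\mathcal{X}(B,p^* ):=\bigcup_{(\bar x,\bar x_{n+1})\in\Delta\cap(S\times\mathbb{Z}_+)}\ \bigcup_{i=0}^{\bar x_{n+1}}\big(R_B(\bar x-\bar x_{n+1}p^* )+ip^*\big).$$ *)

theory Defs
  imports "HOL-Analysis.Analysis"
begin

section \<open>The sets \<open>S\<close>\<close>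

definition integer_vectors :: "(real ^ 'n) set" where
  "integer_vectors = {z. \<forall>i. z $ i \<in> \<int>}"

text \<open>The library's \<^const>\<open>polyhedron\<close>, with rational data for every half-space.\<close>

definition rational_polyhedron :: "(real ^ 'n) set \<Rightarrow> bool" where
  "rational_polyhedron Q \<longleftrightarrow>
     (\<exists>F. finite F \<and> Q = \<Inter>F \<and>
        (\<forall>h\<in>F. \<exists>c d. c \<noteq> 0 \<and> (\<forall>i. c $ i \<in> \<rat>) \<and> d \<in> \<rat> \<and> h = {x. c \<bullet> x \<le> d}))"

section \<open>Valid pairs and liftings\<close>

text \<open>The matrices \<open>R\<close> and \<open>P\<close> are given by their columns \<open>R i\<close>, \<open>i < k\<close>, and \<open>P j\<close>, \<open>j < l\<close>;
  values at larger indices are irrelevant.\<close>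

definition X_S ::
  "(real ^ 'n) set \<Rightarrow> nat \<Rightarrow> nat \<Rightarrow> (nat \<Rightarrow> real ^ 'n) \<Rightarrow> (nat \<Rightarrow> real ^ 'n)
     \<Rightarrow> ((nat \<Rightarrow> real) \<times> (nat \<Rightarrow> real)) set" where
  "X_S S k l R P =
     {(s, y). (\<forall>i<k. 0 \<le> s i) \<and> (\<forall>j<l. y j \<in> \<nat>) \<and>
        (\<Sum>i<k. s i *\<^sub>R R i) + (\<Sum>j<l. y j *\<^sub>R P j) \<in> S}"

definition valid_pair ::
  "(real ^ 'n) set \<Rightarrow> (real ^ 'n \<Rightarrow> real) \<Rightarrow> (real ^ 'n \<Rightarrow> real) \<Rightarrow> bool" where
  "valid_pair S \<psi> \<pi> \<longleftrightarrow>
     (\<forall>k l R P. (k, l) \<noteq> (0, 0) \<longrightarrow>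
        (\<forall>(s, y) \<in> X_S S k l R P.
           (\<Sum>i<k. \<psi> (R i) * s i) + (\<Sum>j<l. \<pi> (P j) * y j) \<ge> 1))"

definition lifting ::
  "(real ^ 'n) set \<Rightarrow> (real ^ 'n \<Rightarrow> real) \<Rightarrow> (real ^ 'n \<Rightarrow> real) \<Rightarrow> bool" where
  "lifting S \<psi> \<pi> \<longleftrightarrow> valid_pair S \<psi> \<pi>"

definition minimal_lifting ::
  "(real ^ 'n) set \<Rightarrow> (real ^ 'n \<Rightarrow> real) \<Rightarrow> (real ^ 'n \<Rightarrow> real) \<Rightarrow> bool" where
  "minimal_lifting S \<psi> \<pi> \<longleftrightarrow>
     lifting S \<psi> \<pi> \<and> (\<forall>\<pi>'. lifting S \<psi> \<pi>' \<and> (\<forall>p. \<pi>' p \<le> \<pi> p) \<longrightarrow> \<pi>' = \<pi>)"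

text \<open>For nonempty \<open>S\<close> the values of liftings at \<open>p\<close> are bounded below: if \<open>x \<in> S\<close>, validity
  applied to \<open>x = (x - p) + p\<close> gives \<open>\<pi> p \<ge> 1 - \<psi> (x - p)\<close>.  So the infimum may be taken in the
  reals.  (If \<open>S\<close> is empty, there are no minimal liftings.)\<close>

definition V :: "(real ^ 'n) set \<Rightarrow> (real ^ 'n \<Rightarrow> real) \<Rightarrow> real ^ 'n \<Rightarrow> real" where
  "V S \<psi> p = Inf {\<pi> p |\<pi>. minimal_lifting S \<psi> \<pi>}"

definition optimal_liftings ::
  "(real ^ 'n) set \<Rightarrow> (real ^ 'n \<Rightarrow> real) \<Rightarrow> real ^ 'n \<Rightarrow> (real ^ 'n \<Rightarrow> real) set" where
  "optimal_liftings S \<psi> p = {\<pi>. minimal_lifting S \<psi> \<pi> \<and> \<pi> p = V S \<psi> p}"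

definition fixing_region ::
  "(real ^ 'n) set \<Rightarrow> (real ^ 'n \<Rightarrow> real) \<Rightarrow> real ^ 'n \<Rightarrow> (real ^ 'n) set" where
  "fixing_region S \<psi> p =
     {q. \<forall>\<pi>1\<in>optimal_liftings S \<psi> p. \<forall>\<pi>2\<in>optimal_liftings S \<psi> p. \<pi>1 q = \<pi>2 q}"

section \<open>\<open>S\<close>-free sets\<close>

definition S_free_nbhd :: "(real ^ 'n) set \<Rightarrow> (real ^ 'n) set \<Rightarrow> bool" where
  "S_free_nbhd S B \<longleftrightarrow> convex B \<and> 0 \<in> interior B \<and> S \<inter> interior B = {}"

definition maximal_S_free_nbhd :: "(real ^ 'n) set \<Rightarrow> (real ^ 'n) set \<Rightarrow> bool" where
  "maximal_S_free_nbhd S B \<longleftrightarrow>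
     S_free_nbhd S B \<and> \<not> (\<exists>B'. B \<subset> B' \<and> S_free_nbhd S B')"

text \<open>The index set \<open>I\<close> indexes the facets of \<open>B\<close>.  This matters: a redundant inequality
  (for instance \<open>a i = 0\<close>) would not change \<open>B\<close> but could change \<open>\<psi>\<close>.\<close>

definition facet_description ::
  "(real ^ 'n) set \<Rightarrow> 'i set \<Rightarrow> ('i \<Rightarrow> real ^ 'n) \<Rightarrow> bool" where
  "facet_description B I a \<longleftrightarrow>
     finite I \<and> B = {r. \<forall>i\<in>I. a i \<bullet> r \<le> 1} \<and>
     bij_betw (\<lambda>i. {r \<in> B. a i \<bullet> r = 1}) I {F. F facet_of B}"

text \<open>The maximum is meaningful for nonempty \<open>I\<close>; for a maximal \<open>S\<close>-free \<open>B\<close>, \<open>I\<close> is empty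
  only if \<open>B\<close> is the whole space, that is, if \<open>S\<close> is empty.\<close>

definition psi_B :: "'i set \<Rightarrow> ('i \<Rightarrow> real ^ 'n) \<Rightarrow> real ^ 'n \<Rightarrow> real" where
  "psi_B I a r = Max ((\<lambda>i. a i \<bullet> r) ` I)"

section \<open>The pyramid\<close>

definition Delta ::
  "(real ^ 'n) set \<Rightarrow> 'i set \<Rightarrow> ('i \<Rightarrow> real ^ 'n) \<Rightarrow> real ^ 'n \<Rightarrow> ((real ^ 'n) \<times> real) set" where
  "Delta S I a p =
     {(r, t). 0 \<le> t \<and> (\<forall>i\<in>I. a i \<bullet> r + (V S (psi_B I a) p - a i \<bullet> p) * t \<le> 1)}"

definition psi_Delta ::
  "(real ^ 'n) set \<Rightarrow> 'i set \<Rightarrow> ('i \<Rightarrow> real ^ 'n) \<Rightarrow> real ^ 'n \<Rightarrow> (real ^ 'n) \<times> real \<Rightarrow> real" where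
  "psi_Delta S I a p = (\<lambda>(r, t). Max ((\<lambda>i. a i \<bullet> r + (V S (psi_B I a) p - a i \<bullet> p) * t) ` I))"

definition W :: "'a::real_vector set \<Rightarrow> 'a set" where
  "W T = {w. \<forall>s\<in>T. \<forall>k::int. s + of_int k *\<^sub>R w \<in> T}"

definition W_plus :: "'a::real_vector set \<Rightarrow> 'a set" where
  "W_plus T = {w. \<forall>s\<in>T. \<forall>k::nat. s + of_nat k *\<^sub>R w \<in> T}"

text \<open>The infimum is taken in the extended reals, so that an equation between it and a real
  number includes its finiteness.\<close>

definition psi_star ::
  "(real ^ 'n) set \<Rightarrow> 'i set \<Rightarrow> ('i \<Rightarrow> real ^ 'n) \<Rightarrow> real ^ 'n \<Rightarrow> (real ^ 'n) \<times> real \<Rightarrow> ereal" where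
  "psi_star S I a p v = (INF u\<in>W_plus (S \<times> \<nat>). ereal (psi_Delta S I a p (v + u)))"

section \<open>Spindles\<close>

text \<open>The spindle does not depend on the choice of the maximizing index \<open>k\<close>: if \<open>k\<close> and \<open>k'\<close>
  are both maximizing at \<open>x\<close>, then \<open>(a k' - a k) \<bullet> x = 0\<close>, so the two conditions for \<open>k\<close>
  force \<open>a k' \<bullet> r = a k \<bullet> r\<close>.\<close>

definition spindle ::
  "'i set \<Rightarrow> ('i \<Rightarrow> real ^ 'n) \<Rightarrow> real ^ 'n \<Rightarrow> (real ^ 'n) set" where
  "spindle I a x =
     {r. \<exists>k\<in>I. psi_B I a x = a k \<bullet> x \<and>
        (\<forall>i\<in>I. (a i - a k) \<bullet> r \<le> 0 \<and> (a i - a k) \<bullet> (x - r) \<le> 0)}"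

definition spindle_union ::
  "(real ^ 'n) set \<Rightarrow> 'i set \<Rightarrow> ('i \<Rightarrow> real ^ 'n) \<Rightarrow> real ^ 'n \<Rightarrow> (real ^ 'n) set" where
  "spindle_union S I a p =
     (\<Union>(x, t) \<in> Delta S I a p \<inter> (S \<times> \<nat>). \<Union>i \<in> {i::nat. real i \<le> t}.
        (\<lambda>r. r + real i *\<^sub>R p) ` spindle I a (x - t *\<^sub>R p))"

end

theory Submission
  imports Defs
begin

text \<open>Let \<open>(x, t)\<close> be the lattice point of the pyramid and \<open>q = r + i p\<close> with \<open>r\<close> in the
  spindle of \<open>x - t p\<close>.  On the spindle \<open>\<psi>\<close> is additive, so validity applied to
  \<open>x = q + (x - t p - r) + (t - i) p\<close> forces \<open>\<pi> q \<ge> \<psi> r + i V\<close>, and this is the value of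
  \<open>\<psi>\<^sub>\<Delta>\<close> at \<open>(q, i)\<close>.  Conversely, by minimality \<open>\<pi> q\<close> cannot exceed \<open>\<psi>\<^sub>\<Delta> (q + w, z)\<close>
  for \<open>(w, z)\<close> in \<open>W\<^sup>+\<close>, since otherwise \<open>\<pi>\<close> could be lowered at the single point \<open>q\<close>.\<close>

lemma valid_pairD:
  fixes k l :: nat
  assumes "valid_pair S \<psi> \<pi>" and "(k, l) \<noteq> (0, 0)"
    and "\<And>i. i < k \<Longrightarrow> 0 \<le> s i" and "\<And>j. j < l \<Longrightarrow> y j \<in> \<nat>"
    and "(\<Sum>i<k. s i *\<^sub>R R i) + (\<Sum>j<l. y j *\<^sub>R P j) \<in> S"
  shows "1 \<le> (\<Sum>i<k. \<psi> (R i) * s i) + (\<Sum>j<l. \<pi> (P j) * y j)"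
proof -
  have valid: "\<forall>(s, y) \<in> X_S S k l R P.
      1 \<le> (\<Sum>i<k. \<psi> (R i) * s i) + (\<Sum>j<l. \<pi> (P j) * y j)"
    using assms(1)[unfolded valid_pair_def, rule_format, OF assms(2)] by simp
  have "(s, y) \<in> X_S S k l R P"
    using assms(3-5) by (simp add: X_S_def)
  from bspec[OF valid this] show ?thesis
    by simp
qed

text \<open>The premise also ranges over \<open>k = l = 0\<close>. The proof that uses this rule
  invokes validity of \<pi> with \<open>Suc k\<close> and \<open>Suc l\<close> columns, so the
  degenerate case costs nothing.\<close>

lemma valid_pairI:
  fixes S :: "(real ^ 'n) set"
  assumes "\<And>(k::nat) (l::nat) R P s y. (\<And>i. i < k \<Longrightarrow> 0 \<le> s i) \<Longrightarrow> (\<And>j. j < l \<Longrightarrow> y j \<in> \<nat>) \<Longrightarrow>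
    (\<Sum>i<k. s i *\<^sub>R R i) + (\<Sum>j<l. y j *\<^sub>R P j) \<in> S \<Longrightarrow>
    1 \<le> (\<Sum>i<k. \<psi> (R i) * s i) + (\<Sum>j<l. \<pi> (P j) * y j)"
  shows "valid_pair S \<psi> \<pi>"
  unfolding valid_pair_def
proof (intro allI impI ballI)
  fix k l :: nat and R P :: "nat \<Rightarrow> real ^ 'n" and v
  assume "v \<in> X_S S k l R P"
  then show "case v of (s, y) \<Rightarrow>
      1 \<le> (\<Sum>i<k. \<psi> (R i) * s i) + (\<Sum>j<l. \<pi> (P j) * y j)"
    unfolding X_S_def by clarsimp (blast intro: assms)
qed

lemma W_plusD: "w \<in> W_plus T \<Longrightarrow> x \<in> T \<Longrightarrow> x + real n *\<^sub>R w \<in> T"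
  by (simp add: W_plus_def)

lemma W_subset_W_plus: "W T \<subseteq> W_plus T"
proof
  fix w :: 'a assume w: "w \<in> W T"
  have "x + of_int (int k) *\<^sub>R w \<in> T" if "x \<in> T" for x k
    using w that unfolding W_def by blast
  then show "w \<in> W_plus T"
    by (simp add: W_plus_def)
qed

lemma uminus_mem_W: "w \<in> W T \<Longrightarrow> - w \<in> W T"
proof -
  assume w: "w \<in> W T"
  have "x + of_int (- k) *\<^sub>R w \<in> T" if "x \<in> T" for x k
    using w that unfolding W_def by blast
  then show ?thesis
    by (simp add: W_def)
qed

text \<open>Translating points \<open>(x, 0)\<close> exposes both coordinates. For empty
  \<open>S\<close> every pair would lie in \<open>W_plus\<close>, hence the second premise.\<close>

lemma W_plus_Times_Nats_D:
  assumes "(w, z) \<in> W_plus (S \<times> (\<nat> :: real set))" and "S \<noteq> {}"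
  shows "w \<in> W_plus S" and "z \<in> \<nat>"
proof -
  have *: "(x, 0) + real n *\<^sub>R (w, z) \<in> S \<times> \<nat>" if "x \<in> S" for x n
    using W_plusD[OF assms(1), of "(x, 0)" n] that by simp
  then show "w \<in> W_plus S"
    by (simp add: W_plus_def)
  obtain x where "x \<in> S"
    using assms(2) by blast
  from *[OF this, of 1] show "z \<in> \<nat>"
    by simp
qed

lemma zero_of_nat_mem_W_plus: "(0, real i) \<in> W_plus (S \<times> \<nat>)"
  by (auto simp: W_plus_def)

text \<open>If the bound failed, every occurrence of the column \<open>q\<close> could be traded for \<open>u\<close> and
  \<open>z\<close> copies of \<open>p\<close>, which only shifts the point by a multiple of \<open>w\<close>.\<close>

lemma minimal_lifting_le:
  fixes q :: "real ^ 'n"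
  assumes min: "minimal_lifting S \<psi> \<pi>" and w: "w \<in> W_plus S"
    and q: "q + w = u + real z *\<^sub>R p"
  shows "\<pi> q \<le> \<psi> u + \<pi> p * real z"
proof (rule ccontr)
  define v where "v = \<psi> u + \<pi> p * real z"
  define \<pi>' where "\<pi>' = \<pi>(q := v)"
  assume "\<not> ?thesis"
  then have less: "v < \<pi> q"
    by (simp add: v_def)
  have valid: "valid_pair S \<psi> \<pi>"
    using min by (simp add: minimal_lifting_def lifting_def)
  have "valid_pair S \<psi> \<pi>'"
  proof (rule valid_pairI)
    fix k l :: nat and R P :: "nat \<Rightarrow> real ^ 'n" and s y :: "nat \<Rightarrow> real"
    assume s: "\<And>i. i < k \<Longrightarrow> 0 \<le> s i" and y: "\<And>j. j < l \<Longrightarrow> y j \<in> \<nat>"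
      and mem: "(\<Sum>i<k. s i *\<^sub>R R i) + (\<Sum>j<l. y j *\<^sub>R P j) \<in> S"
    \<comment> \<open>\<open>N\<close> is the total multiplicity of \<open>q\<close>, which may be
      the value of several columns; \<open>y0\<close> keeps the rest.\<close>
    define y0 where "y0 j = (if P j = q then 0 else y j)" for j
    define N where "N = (\<Sum>j<l. if P j = q then y j else 0)"
    have "N \<in> \<nat>"
      unfolding N_def using y by (induction l) (auto intro: Nats_add)
    then obtain n where n: "N = real n"
      by (auto elim: Nats_cases)
    have split_sum: "(\<Sum>j<l. y j *\<^sub>R P j) = N *\<^sub>R q + (\<Sum>j<l. y0 j *\<^sub>R P j)"
      unfolding N_def y0_def scaleR_sum_left sum.distrib[symmetric]
      by (rule sum.cong) auto
    have split_value: "(\<Sum>j<l. \<pi>' (P j) * y j) = N * v + (\<Sum>j<l. \<pi> (P j) * y0 j)"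
      unfolding N_def y0_def \<pi>'_def sum_distrib_right sum.distrib[symmetric]
      by (rule sum.cong) auto
    \<comment> \<open>One extra continuous column \<open>u\<close> with weight \<open>N\<close> and
      one extra integer column \<open>p\<close> with weight \<open>N * real z\<close> replace all
      copies of \<open>q\<close>.\<close>
    define R' s' P' y' where "R' = R(k := u)" and "s' = s(k := N)"
      and "P' = P(l := p)" and "y' = y0(l := N * real z)"
    have "(\<Sum>i<Suc k. s' i *\<^sub>R R' i) + (\<Sum>j<Suc l. y' j *\<^sub>R P' j)
        = (\<Sum>i<k. s i *\<^sub>R R i) + (\<Sum>j<l. y0 j *\<^sub>R P j) + N *\<^sub>R (u + real z *\<^sub>R p)"
      by (simp add: R'_def s'_def P'_def y'_def algebra_simps)
    \<comment> \<open>Each traded copy of \<open>q\<close> moves the point by \<open>w\<close>;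
      since \<open>N\<close> is a natural number, \<open>W_plus\<close> keeps it in
      \<open>S\<close>.\<close>
    also have "\<dots> = (\<Sum>i<k. s i *\<^sub>R R i) + (\<Sum>j<l. y j *\<^sub>R P j) + real n *\<^sub>R w"
      unfolding q[symmetric] split_sum n by (simp add: algebra_simps)
    also have "\<dots> \<in> S"
      using W_plusD[OF w mem] .
    finally have "1 \<le> (\<Sum>i<Suc k. \<psi> (R' i) * s' i) + (\<Sum>j<Suc l. \<pi> (P' j) * y' j)"
    proof (intro valid_pairD[OF valid])
      show "0 \<le> s' i" if "i < Suc k" for i
        using s that n by (auto simp: s'_def)
      show "y' j \<in> \<nat>" if "j < Suc l" for j
        using y that n by (auto simp: y'_def y0_def intro: Nats_mult)
    qed auto
    also have "\<dots> = (\<Sum>i<k. \<psi> (R i) * s i) + (\<Sum>j<l. \<pi>' (P j) * y j)"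
      unfolding split_value v_def
      by (simp add: R'_def s'_def P'_def y'_def algebra_simps)
    finally show "1 \<le> (\<Sum>i<k. \<psi> (R i) * s i) + (\<Sum>j<l. \<pi>' (P j) * y j)" .
  qed
  moreover have "\<forall>r. \<pi>' r \<le> \<pi> r"
    using less by (simp add: \<pi>'_def)
  ultimately have "\<pi>' = \<pi>"
    using min by (simp add: minimal_lifting_def lifting_def)
  then have "\<pi>' q = \<pi> q"
    by simp
  with less show False
    by (simp add: \<pi>'_def)
qed

text \<open>The previous bound with \<open>u = 0\<close> and \<open>z = 1\<close>, the shifted point
  playing the part of \<open>p\<close>, is used for both \<open>w\<close> and
  \<open>- w\<close>.\<close>

lemma minimal_lifting_W_invariant:
  assumes min: "minimal_lifting S \<psi> \<pi>" and "\<psi> 0 = 0" and w: "w \<in> W S"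
  shows "\<pi> (q + w) = \<pi> q"
proof (rule antisym)
  have "- w \<in> W_plus S" "w \<in> W_plus S"
    using uminus_mem_W[OF w] w W_subset_W_plus[of S] by auto
  then show "\<pi> (q + w) \<le> \<pi> q" "\<pi> q \<le> \<pi> (q + w)"
    using minimal_lifting_le[OF min, of "- w" "q + w" 0 1 q]
      minimal_lifting_le[OF min, of w q 0 1 "q + w"] \<open>\<psi> 0 = 0\<close>
    by simp_all
qed

text \<open>The term \<open>V * t\<close> is common to all \<open>i\<close> and leaves the maximum.
  What remains is the form of the bound in \<open>minimal_lifting_le\<close>, with
  \<open>u = r - t *\<^sub>R p\<close>.\<close>

lemma psi_Delta_eq:
  assumes "finite I" and "I \<noteq> {}"
  shows "psi_Delta S I a p (r, t) = psi_B I a (r - t *\<^sub>R p) + V S (psi_B I a) p * t"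
proof -
  have "a i \<bullet> r + (V S (psi_B I a) p - a i \<bullet> p) * t
      = a i \<bullet> (r - t *\<^sub>R p) + V S (psi_B I a) p * t" for i
    by (simp add: inner_diff_right algebra_simps)
  then show ?thesis
    by (simp add: psi_Delta_def Max_add_commute[OF assms] psi_B_def[of I a "r - t *\<^sub>R p"])
qed

lemma psi_B_le_of_mem_Delta:
  assumes "finite I" and "I \<noteq> {}" and "(x, t) \<in> Delta S I a p"
  shows "psi_B I a (x - t *\<^sub>R p) + V S (psi_B I a) p * t \<le> 1"
proof -
  have "psi_Delta S I a p (x, t) \<le> 1"
    using assms by (simp add: psi_Delta_def Delta_def)
  then show ?thesis
    by (simp add: psi_Delta_eq[OF assms(1,2)])
qed

lemma psi_B_eqI:
  assumes "finite I" and "k \<in> I" and "\<And>i. i \<in> I \<Longrightarrow> (a i - a k) \<bullet> r \<le> 0"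
  shows "psi_B I a r = a k \<bullet> r"
  unfolding psi_B_def using assms by (intro Max_eqI) (auto simp: inner_diff_left)

text \<open>The same index \<open>k\<close> is maximizing at \<open>x\<close>, \<open>r\<close> and
  \<open>x - r\<close>, so \<psi> agrees with one linear form at all three.\<close>

lemma psi_B_additive_on_spindle:
  assumes "finite I" and "r \<in> spindle I a x"
  shows "psi_B I a r + psi_B I a (x - r) = psi_B I a x"
proof -
  obtain k where k: "k \<in> I" "psi_B I a x = a k \<bullet> x"
    "\<And>i. i \<in> I \<Longrightarrow> (a i - a k) \<bullet> r \<le> 0" "\<And>i. i \<in> I \<Longrightarrow> (a i - a k) \<bullet> (x - r) \<le> 0"
    using assms(2) by (auto simp: spindle_def)
  show ?thesis
    using psi_B_eqI[where a = a, OF assms(1) k(1) k(3)]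
      psi_B_eqI[where a = a, OF assms(1) k(1) k(4)] k(2)
    by (simp add: inner_diff_right)
qed

lemma optimal_lifting_le_psi_star:
  fixes p :: "real ^ 'n"
  assumes "finite I" and "I \<noteq> {}" and "S \<noteq> {}"
    and opt: "\<pi> \<in> optimal_liftings S (psi_B I a) p"
  shows "ereal (\<pi> q) \<le> psi_star S I a p (q, 0)"
  unfolding psi_star_def
proof (rule INF_greatest, clarify)
  fix w :: "real ^ 'n" and z :: real
  assume wz: "(w, z) \<in> W_plus (S \<times> \<nat>)"
  have min: "minimal_lifting S (psi_B I a) \<pi>" and V: "\<pi> p = V S (psi_B I a) p"
    using opt by (auto simp: optimal_liftings_def)
  obtain m where m: "z = real m"
    using W_plus_Times_Nats_D(2)[OF wz assms(3)] by (auto elim: Nats_cases)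
  have "\<pi> q \<le> psi_B I a (q + w - real m *\<^sub>R p) + \<pi> p * real m"
    using W_plus_Times_Nats_D(1)[OF wz assms(3)] by (intro minimal_lifting_le[OF min]) auto
  then show "ereal (\<pi> q) \<le> ereal (psi_Delta S I a p ((q, 0) + (w, z)))"
    by (simp add: psi_Delta_eq[OF assms(1,2)] V m)
qed

text \<open>Integer columns are indexed by position, so \<open>q = p\<close> is allowed.\<close>

lemma valid_pair_three_terms:
  assumes valid: "valid_pair S \<psi> \<pi>" and "u + q + real n *\<^sub>R p \<in> S"
  shows "1 \<le> \<psi> u + \<pi> q + \<pi> p * real n"
proof -
  define P where "P = (\<lambda>j::nat. if j = 0 then q else p)"
  define y where "y = (\<lambda>j::nat. if j = 0 then 1 else real n)"
  have two: "{..<2} = {0, 1::nat}"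
    by auto
  have "1 \<le> (\<Sum>i<(1::nat). \<psi> ((\<lambda>_. u) i) * (\<lambda>_. 1) i) + (\<Sum>j<2. \<pi> (P j) * y j)"
    by (rule valid_pairD[OF valid]) (use assms(2) in \<open>auto simp: P_def y_def two add.assoc\<close>)
  then show ?thesis
    by (simp add: P_def y_def two)
qed

lemma optimal_lifting_eq_psi_star:
  assumes "finite I" and opt: "\<pi> \<in> optimal_liftings S (psi_B I a) p"
    and q: "q \<in> spindle_union S I a p"
  shows "ereal (\<pi> q) = psi_star S I a p (q, 0)"
proof -
  let ?\<psi> = "psi_B I a"
  obtain x t i r where xt: "(x, t) \<in> Delta S I a p" "x \<in> S" "t \<in> \<nat>" and i: "real i \<le> t"
    and r: "r \<in> spindle I a (x - t *\<^sub>R p)" and q_eq: "q = r + real i *\<^sub>R p"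
    using q by (auto simp: spindle_union_def)
  \<comment> \<open>A spindle point comes with a maximizing index in \<open>I\<close>, and the
    pyramid point with an element of \<open>S\<close>.\<close>
  have I: "I \<noteq> {}" and S: "S \<noteq> {}"
    using r xt(2) by (auto simp: spindle_def)
  have V: "\<pi> p = V S ?\<psi> p" and valid: "valid_pair S ?\<psi> \<pi>"
    using opt by (auto simp: optimal_liftings_def minimal_lifting_def lifting_def)
  obtain m where m: "t = real m" "i \<le> m"
    using xt(3) i by (auto elim: Nats_cases)
  have x_eq: "(x - t *\<^sub>R p - r) + q + real (m - i) *\<^sub>R p = x"
    using m by (simp add: q_eq of_nat_diff algebra_simps)
  have "1 \<le> ?\<psi> (x - t *\<^sub>R p - r) + \<pi> q + \<pi> p * real (m - i)"
    using xt(2) by (intro valid_pair_three_terms[OF valid]) (simp add: x_eq)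
  \<comment> \<open>Additivity rewrites the first term as \<psi> at \<open>x - t *\<^sub>R p\<close>
    minus \<psi> at \<open>r\<close>; the pyramid bounds the former by \<open>1 - V * t\<close>, and
    \<open>m - i\<close> copies of \<open>V\<close> cancel.\<close>
  then have "?\<psi> r + \<pi> p * real i \<le> \<pi> q"
    using psi_B_additive_on_spindle[OF assms(1) r]
      psi_B_le_of_mem_Delta[OF assms(1) I xt(1)] m V
    by (simp add: of_nat_diff algebra_simps)
  \<comment> \<open>The shift \<open>(0, real i)\<close> attains the infimum: as
    \<open>q - real i *\<^sub>R p = r\<close>, its value is the lower bound just found.\<close>
  moreover have "psi_star S I a p (q, 0) \<le> ereal (psi_Delta S I a p ((q, 0) + (0, real i)))"
    unfolding psi_star_def by (intro INF_lower zero_of_nat_mem_W_plus)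
  ultimately have "psi_star S I a p (q, 0) \<le> ereal (\<pi> q)"
    by (simp add: psi_Delta_eq[OF assms(1) I] q_eq V) (meson ereal_less_eq(3) order_trans)
  with optimal_lifting_le_psi_star[OF assms(1) I S opt] show ?thesis
    by (rule antisym)
qed

theorem theorem3p6:
  fixes b p :: "real ^ 'n" and Q S B :: "(real ^ 'n) set"
    and I :: "'i set" and a :: "'i \<Rightarrow> real ^ 'n" and \<psi> :: "real ^ 'n \<Rightarrow> real"
  assumes "b \<notin> integer_vectors"
    and "rational_polyhedron Q"
    and "S = ((\<lambda>z. b + z) ` integer_vectors) \<inter> Q"
    and "maximal_S_free_nbhd S B"
    and "facet_description B I a"
    and "\<psi> = psi_B I a"
  shows "{q + w |q w. q \<in> spindle_union S I a p \<and> w \<in> W S} \<subseteq> fixing_region S \<psi> p \<and>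
    (\<forall>\<pi> \<in> optimal_liftings S \<psi> p. \<forall>q \<in> spindle_union S I a p. \<forall>w \<in> W S.
       \<pi> (q + w) = \<pi> q \<and> ereal (\<pi> q) = psi_star S I a p (q, 0))"
proof -
  have fin: "finite I"
    using assms(5) by (simp add: facet_description_def)
  have value_eq: "\<pi> (q + w) = \<pi> q \<and> ereal (\<pi> q) = psi_star S I a p (q, 0)"
    if "\<pi> \<in> optimal_liftings S \<psi> p" "q \<in> spindle_union S I a p" "w \<in> W S" for \<pi> q w
  proof
    have "I \<noteq> {}"
      using that(2) by (auto simp: spindle_union_def spindle_def)
    then have "\<psi> 0 = 0"
      by (simp add: assms(6) psi_B_def image_constant_conv)
    then show "\<pi> (q + w) = \<pi> q"
      using that(1,3) by (auto simp: optimal_liftings_def intro: minimal_lifting_W_invariant)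
    show "ereal (\<pi> q) = psi_star S I a p (q, 0)"
      using that(1,2) unfolding assms(6) by (rule optimal_lifting_eq_psi_star[OF fin])
  qed
  \<comment> \<open>\<open>psi_star\<close> does not depend on the lifting, so all optimal liftings
    agree at \<open>q\<close>, and by invariance at \<open>q + w\<close>.\<close>
  have "\<pi>1 (q + w) = \<pi>2 (q + w)"
    if "q \<in> spindle_union S I a p" "w \<in> W S"
      "\<pi>1 \<in> optimal_liftings S \<psi> p" "\<pi>2 \<in> optimal_liftings S \<psi> p" for q w \<pi>1 \<pi>2
    using value_eq[OF that(3,1,2)] value_eq[OF that(4,1,2)] by (metis ereal.inject)
  then have "{q + w |q w. q \<in> spindle_union S I a p \<and> w \<in> W S} \<subseteq> fixing_region S \<psi> p"
    by (auto simp: fixing_region_def)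
  with value_eq show ?thesis
    by blast
qed

end
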